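(* Let $A \in \mathbb{R}^{d\times d}$ be invertible, $\bm{b}\in\mathbb{R}^d$, $\bm{x}^\ast=A^{-1}\bm{b}$, $\bm{x}_0\in\mathbb{R}^d$ with $\bm{x}_0\neq\bm{x}^\ast$, and $\Sigma_0$ symmetric positive-definite. Let $S_m\in\mathbb{R}^{d\times m}$ have linearly independent columns, $\Lambda_m=S_m^\top A\Sigma_0A^\top S_m$, $\bm{r}_0=\bm{b}-A\bm{x}_0$, and \[\bm{x}_m=\bm{x}_0+\Sigma_0A^\top S_m\Lambda_m^{-1}S_m^\top\bm{r}_0,\qquad \Sigma_m=\Sigma_0-\Sigma_0A^\top S_m\Lambda_m^{-1}S_m^\top A\Sigma_0.\] Then \[\frac{\|\bm{x}_m-\bm{x}^\ast\|_{\Sigma_0^{-1}}}{\|\bm{x}_0-\bm{x}^\ast\|_{\Sigma_0^{-1}}}\le\sqrt{\operatorname{tr}(\Sigma_m\Sigma_0^{-1})}.\]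
   Context: For a symmetric positive-definite matrix $M$, $\|\bm{v}\|_M=\sqrt{\bm{v}^\top M\bm{v}}$. $\bm{x}_m,\Sigma_m$ are the mean and covariance of the posterior obtained by conditioning the prior $\mathcal{N}(\bm{x}_0,\Sigma_0)$ on $S_m^\top A\bm{x}=S_m^\top\bm{b}$. *)

theory Defs
  imports "HOL-Analysis.Analysis"
begin

text \<open>Weighted norm \<open>\<parallel>v\<parallel>_M = sqrt (v^T M v)\<close>.\<close>
definition mnorm :: "real^'n^'n \<Rightarrow> real^'n \<Rightarrow> real" where
  "mnorm M v = sqrt (v \<bullet> (M *v v))"

definition sym_pos_def_mat :: "real^'n^'n \<Rightarrow> bool" where
  "sym_pos_def_mat M \<longleftrightarrow> transpose M = M \<and> (\<forall>v. v \<noteq> 0 \<longrightarrow> v \<bullet> (M *v v) > 0)"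

text \<open>Columns of S are linearly independent: only the trivial combination vanishes.\<close>
definition lin_indep_columns :: "real^'m^'d \<Rightarrow> bool" where
  "lin_indep_columns S \<longleftrightarrow> (\<forall>c. S *v c = 0 \<longrightarrow> c = 0)"

end

theory Submission
  imports Defs
begin

text \<open>Write \<open>W = \<Sigma>\<^sub>0\<^sup>-\<^sup>1\<close>, \<open>B = A\<^sup>T S\<^sub>m\<close> and \<open>e = x\<^sub>0 - x\<^sup>*\<close>. Since \<open>S\<^sub>m\<^sup>T r\<^sub>0 = - B\<^sup>T e\<close>, the
  posterior error is \<open>x\<^sub>m - x\<^sup>* = e - P e\<close> with \<open>P = \<Sigma>\<^sub>0 B (B\<^sup>T \<Sigma>\<^sub>0 B)\<^sup>-\<^sup>1 B\<^sup>T\<close>, the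
  \<open>W\<close>-orthogonal projection onto the range of \<open>\<Sigma>\<^sub>0 B\<close>. Hence the error ratio is at most 1,
  while \<open>\<Sigma>\<^sub>m W = I - P\<close> has trace \<open>d - m\<close>. If \<open>m < d\<close> the right-hand side is at least 1;
  if \<open>m = d\<close> then \<open>P = I\<close> and the posterior mean is exact.\<close>

lemma matrix_inv_right:
  fixes M :: "'a::semiring_1^'n^'m"
  assumes "invertible M"
  shows "M ** matrix_inv M = mat 1"
  using someI_ex[OF assms[unfolded invertible_def]] by (simp add: matrix_inv_def)

lemma matrix_inv_left:
  fixes M :: "'a::semiring_1^'n^'m"
  assumes "invertible M"
  shows "matrix_inv M ** M = mat 1"
  using someI_ex[OF assms[unfolded invertible_def]] by (simp add: matrix_inv_def)

lemma invertible_if_kernel_trivial: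
  fixes M :: "real^'n^'n"
  assumes "\<And>x. M *v x = 0 \<Longrightarrow> x = 0"
  shows "invertible M"
  using assms invertible_left_inverse matrix_left_invertible_ker by blast

lemma inner_matrix_vector_transpose:
  fixes M :: "real^'n^'m"
  shows "x \<bullet> (M *v y) = (transpose M *v x) \<bullet> y"
  by (metis dot_lmul_matrix transpose_transpose vector_transpose_matrix)

lemma matrix_diff_rdistrib:
  fixes X Y :: "'a::ring_1^'n^'m" and Z :: "'a^'k^'n"
  shows "(X - Y) ** Z = X ** Z - Y ** Z"
  by (simp add: matrix_matrix_mult_def vec_eq_iff algebra_simps sum_subtractf)

lemma lin_indep_columns_card_le:
  fixes S :: "real^'m^'d"
  assumes "lin_indep_columns S"
  shows "CARD('m) \<le> CARD('d)"
  using assms rank_bound[of S] full_rank_injective[of S] vec.inj_iff_eq_0[of S]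
  unfolding lin_indep_columns_def by auto

lemma lin_indep_columns_square_invertible:
  fixes S :: "real^'m^'d"
  assumes "lin_indep_columns S" and "CARD('m) = CARD('d)"
  shows "invertible S"
proof -
  have "inj ((*v) S)"
    using assms(1) vec.inj_iff_eq_0 unfolding lin_indep_columns_def by blast
  then have "surj ((*v) S)"
    using assms(2) full_rank_injective full_rank_surjective by metis
  obtain L where L: "L ** S = mat 1"
    using \<open>inj ((*v) S)\<close> matrix_left_invertible_injective by blast
  obtain R where R: "S ** R = mat 1"
    using \<open>surj ((*v) S)\<close> matrix_right_invertible_surjective by blast
  have "L = R"
    by (metis L R matrix_mul_assoc matrix_mul_lid matrix_mul_rid)
  then show ?thesis
    using L R unfolding invertible_def by blast
qed

lemma lin_indep_columns_mult:
  fixes A :: "real^'d^'d" and S :: "real^'m^'d"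
  assumes "invertible A" and "lin_indep_columns S"
  shows "lin_indep_columns (A ** S)"
  using assms inj_matrix_vector_mult[OF assms(1)]
  unfolding lin_indep_columns_def
  by (metis injD matrix_vector_mul_assoc matrix_vector_mult_0_right)

lemma sym_pos_def_mat_invertible:
  assumes "sym_pos_def_mat M"
  shows "invertible M"
  using assms unfolding sym_pos_def_mat_def
  by (metis inner_zero_right invertible_if_kernel_trivial less_irrefl)

lemma sym_pos_def_mat_inverse_nonneg:
  assumes "sym_pos_def_mat M"
  shows "0 \<le> v \<bullet> (matrix_inv M *v v)"
proof -
  define w where "w = matrix_inv M *v v"
  have "M *v w = v"
    using matrix_inv_right[OF sym_pos_def_mat_invertible[OF assms]]
    by (simp add: w_def matrix_vector_mul_assoc)
  then have "v \<bullet> (matrix_inv M *v v) = w \<bullet> (M *v w)"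
    by (simp add: w_def inner_commute)
  then show ?thesis
    using assms unfolding sym_pos_def_mat_def
    by (metis inner_zero_left less_eq_real_def)
qed

lemma sym_pos_def_mat_congruence:
  fixes M :: "real^'d^'d" and B :: "real^'m^'d"
  assumes "sym_pos_def_mat M" and "lin_indep_columns B"
  shows "sym_pos_def_mat (transpose B ** M ** B)"
  unfolding sym_pos_def_mat_def
proof
  show "transpose (transpose B ** M ** B) = transpose B ** M ** B"
    using assms(1) by (simp add: sym_pos_def_mat_def matrix_transpose_mul matrix_mul_assoc)
  show "\<forall>c. c \<noteq> 0 \<longrightarrow> 0 < c \<bullet> ((transpose B ** M ** B) *v c)"
  proof (intro allI impI)
    fix c :: "real^'m" assume "c \<noteq> 0"
    then have "B *v c \<noteq> 0" using assms(2) unfolding lin_indep_columns_def by blast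
    moreover have "c \<bullet> ((transpose B ** M ** B) *v c) = (B *v c) \<bullet> (M *v (B *v c))"
      unfolding matrix_vector_mul_assoc[symmetric] inner_matrix_vector_transpose[of c "transpose B"]
      by simp
    ultimately show "0 < c \<bullet> ((transpose B ** M ** B) *v c)"
      using assms(1) unfolding sym_pos_def_mat_def by simp
  qed
qed

definition weighted_proj :: "real^'d^'d \<Rightarrow> real^'m^'d \<Rightarrow> real^'d^'d" where
  "weighted_proj M B = M ** B ** matrix_inv (transpose B ** M ** B) ** transpose B"

context
  fixes M :: "real^'d^'d" and B :: "real^'m^'d"
  assumes spd: "sym_pos_def_mat M" and indep: "lin_indep_columns B"
begin

lemma gram_matrix_inv_right:
  "(transpose B ** M ** B) ** matrix_inv (transpose B ** M ** B) = mat 1"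
  by (intro matrix_inv_right sym_pos_def_mat_invertible sym_pos_def_mat_congruence spd indep)

lemma transpose_mult_weighted_proj: "transpose B ** weighted_proj M B = transpose B"
  using gram_matrix_inv_right by (simp add: weighted_proj_def matrix_mul_assoc)

lemma transpose_mult_weighted_proj_residual:
  "transpose B *v (e - weighted_proj M B *v e) = 0"
  by (simp add: matrix_vector_mult_diff_distrib matrix_vector_mul_assoc
      transpose_mult_weighted_proj)

lemma trace_weighted_proj: "trace (weighted_proj M B) = real CARD('m)"
proof -
  have "trace (weighted_proj M B)
      = trace (transpose B ** (M ** B ** matrix_inv (transpose B ** M ** B)))"
    unfolding weighted_proj_def by (rule trace_mul_sym)
  also have "\<dots> = trace (mat 1 :: real^'m^'m)"
    using gram_matrix_inv_right by (simp add: matrix_mul_assoc)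
  finally show ?thesis by (simp add: trace_I)
qed

lemma weighted_proj_square_eq_id:
  assumes "CARD('m) = CARD('d)"
  shows "weighted_proj M B = mat 1"
proof -
  have "transpose (matrix_inv B) ** transpose B = mat 1"
    using matrix_inv_right[OF lin_indep_columns_square_invertible[OF indep assms]]
    by (simp add: matrix_transpose_mul[symmetric])
  then have "transpose (matrix_inv B) ** (transpose B ** weighted_proj M B) = weighted_proj M B"
    by (simp add: matrix_mul_assoc)
  then show ?thesis
    using \<open>transpose (matrix_inv B) ** transpose B = mat 1\<close>
    by (simp add: transpose_mult_weighted_proj)
qed

text \<open>Pythagoras in the \<open>M\<^sup>-\<^sup>1\<close> inner product: both cross terms reduce to
  \<open>r \<bullet> B u = B\<^sup>T r \<bullet> u\<close> for the residual \<open>r\<close>, and \<open>B\<^sup>T r = 0\<close>.\<close>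
lemma weighted_proj_pythagoras:
  defines "W \<equiv> matrix_inv M" and "P \<equiv> weighted_proj M B"
  shows "e \<bullet> (W *v e) = (e - P *v e) \<bullet> (W *v (e - P *v e)) + (P *v e) \<bullet> (W *v (P *v e))"
proof -
  define r where "r = e - P *v e"
  define u where "u = matrix_inv (transpose B ** M ** B) *v (transpose B *v e)"
  have M_sym: "transpose M = M" using spd unfolding sym_pos_def_mat_def by simp
  have MW: "M *v (W *v x) = x" and WM: "W *v (M *v x) = x" for x
    using sym_pos_def_mat_invertible[OF spd]
    by (simp_all add: W_def matrix_vector_mul_assoc matrix_inv_right matrix_inv_left)
  have Pe: "P *v e = M *v (B *v u)"
    by (simp add: P_def u_def weighted_proj_def matrix_vector_mul_assoc matrix_mul_assoc
        del: transpose_matrix_vector)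
  have "transpose B *v r = 0"
    unfolding r_def P_def by (rule transpose_mult_weighted_proj_residual)
  then have r_orth: "r \<bullet> (B *v u) = 0"
    by (simp only: inner_matrix_vector_transpose[of r B] inner_zero_left)
  have cross1: "r \<bullet> (W *v (P *v e)) = 0"
    using r_orth by (simp add: Pe WM)
  have "(P *v e) \<bullet> (W *v r) = (W *v r) \<bullet> (M *v (B *v u))"
    by (simp add: Pe inner_commute)
  also have "\<dots> = r \<bullet> (B *v u)"
    by (simp add: inner_matrix_vector_transpose[of "W *v r" M] M_sym MW)
  finally have cross2: "(P *v e) \<bullet> (W *v r) = 0"
    using r_orth by simp
  have "e \<bullet> (W *v e) = (r + P *v e) \<bullet> (W *v r + W *v (P *v e))"
    by (simp add: r_def flip: matrix_vector_right_distrib)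
  also have "\<dots> = r \<bullet> (W *v r) + (P *v e) \<bullet> (W *v (P *v e))"
    using cross1 cross2 by (simp add: inner_add_left inner_add_right)
  finally show ?thesis by (simp add: r_def)
qed

lemma mnorm_weighted_proj_residual_le:
  "mnorm (matrix_inv M) (e - weighted_proj M B *v e) \<le> mnorm (matrix_inv M) e"
proof -
  let ?P = "weighted_proj M B"
  have "0 \<le> (?P *v e) \<bullet> (matrix_inv M *v (?P *v e))"
    by (rule sym_pos_def_mat_inverse_nonneg[OF spd])
  then have "(e - ?P *v e) \<bullet> (matrix_inv M *v (e - ?P *v e)) \<le> e \<bullet> (matrix_inv M *v e)"
    using weighted_proj_pythagoras[of e] by linarith
  then show ?thesis
    unfolding mnorm_def by (rule real_sqrt_le_mono)
qed

lemma trace_weighted_proj_complement: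
  "trace ((M - weighted_proj M B ** M) ** matrix_inv M) = real CARD('d) - real CARD('m)"
proof -
  have "(M - weighted_proj M B ** M) ** matrix_inv M = mat 1 - weighted_proj M B"
    using matrix_inv_right[OF sym_pos_def_mat_invertible[OF spd]]
    by (simp add: matrix_diff_rdistrib matrix_mul_assoc[symmetric])
  then show ?thesis by (simp add: trace_sub trace_I trace_weighted_proj)
qed

lemma mnorm_weighted_proj_residual_ratio:
  "mnorm (matrix_inv M) (e - weighted_proj M B *v e) / mnorm (matrix_inv M) e
     \<le> sqrt (trace ((M - weighted_proj M B ** M) ** matrix_inv M))"
proof (cases "CARD('m) = CARD('d)")
  case True
  then have "mnorm (matrix_inv M) (e - weighted_proj M B *v e) = 0"
    by (simp add: weighted_proj_square_eq_id mnorm_def)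
  then show ?thesis
    using True by (simp add: trace_weighted_proj_complement)
next
  case False
  then have "1 \<le> real CARD('d) - real CARD('m)"
    using lin_indep_columns_card_le[OF indep] by linarith
  moreover have "mnorm (matrix_inv M) (e - weighted_proj M B *v e) / mnorm (matrix_inv M) e \<le> 1"
  proof -
    have "0 \<le> mnorm (matrix_inv M) (e - weighted_proj M B *v e)"
      using sym_pos_def_mat_inverse_nonneg[OF spd] by (simp add: mnorm_def)
    then show ?thesis
      using mnorm_weighted_proj_residual_le[of e]
      by (cases "mnorm (matrix_inv M) e = 0") simp_all
  qed
  ultimately show ?thesis
    unfolding trace_weighted_proj_complement using real_sqrt_ge_one order_trans by blast
qed

end

theorem proposition2:
  fixes A Sigma0 :: "real^'d^'d" and b x0 :: "real^'d" and S :: "real^'m^'d"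
  assumes "invertible A"
    and "x0 \<noteq> matrix_inv A *v b"
    and "sym_pos_def_mat Sigma0"
    and "lin_indep_columns S"
  shows "let xstar = matrix_inv A *v b;
             Lambda = transpose S ** A ** Sigma0 ** transpose A ** S;
             r0 = b - A *v x0;
             xm = x0 + (Sigma0 ** transpose A ** S ** matrix_inv Lambda ** transpose S) *v r0;
             Sigmam = Sigma0 - Sigma0 ** transpose A ** S ** matrix_inv Lambda ** transpose S ** A ** Sigma0
         in mnorm (matrix_inv Sigma0) (xm - xstar) / mnorm (matrix_inv Sigma0) (x0 - xstar)
              \<le> sqrt (trace (Sigmam ** matrix_inv Sigma0))"
proof -
  define B where "B = transpose A ** S"
  define Q where "Q = Sigma0 ** transpose A ** S
                        ** matrix_inv (transpose S ** A ** Sigma0 ** transpose A ** S) ** transpose S"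
  define P where "P = weighted_proj Sigma0 B"
  define xstar where "xstar = matrix_inv A *v b"
  have B_indep: "lin_indep_columns B"
    unfolding B_def by (intro lin_indep_columns_mult transpose_invertible assms)
  have QA: "Q ** A = P"
    unfolding Q_def P_def weighted_proj_def B_def matrix_transpose_mul transpose_transpose
      matrix_mul_assoc ..
  have "b - A *v x0 = - (A *v (x0 - xstar))"
    using matrix_inv_right[OF assms(1)]
    by (simp add: xstar_def matrix_vector_mul_assoc matrix_vector_mult_diff_distrib)
  then have "Q *v (b - A *v x0) = - (P *v (x0 - xstar))"
    by (simp add: vec.neg matrix_vector_mul_assoc QA)
  then have xm: "x0 + Q *v (b - A *v x0) - xstar = (x0 - xstar) - P *v (x0 - xstar)"
    by simp
  show ?thesis
    unfolding Let_def Q_def[symmetric] xstar_def[symmetric] QA xm P_def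
    using mnorm_weighted_proj_residual_ratio[OF assms(3) B_indep] .
qed

end
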